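(* Let $K$ be the $2$-uniform tiling of the plane whose vertex types are $[3^4,6^1]$ and $[3^2,6^2]$. If $X$ is a map on the torus that is a quotient $X=K/\Gamma$ of $K$, then the vertices of $X$ form at most $3$ orbits under ${\rm Aut}(X)$.
   Context: A map is a polyhedral map: a cellular embedding of a connected graph in a closed surface such that the intersection of any two distinct faces is empty, a single vertex, or a single edge. For a vertex $u$, the faces containing $u$ form a cyclic sequence (the face-cycle at $u$); if this cyclic sequence consists of consecutive blocks of $n_1$ $p_1$-gons, then $n_2$ $p_2$-gons, ..., then $n_k$ $p_k$-gons, with cyclically consecutive $p_i$ distinct, then $u$ is said to have type $[p_1^{n_1},\dots,p_k^{n_k}]$ (defined up to cyclic shift and reversal). A $2$-uniform tiling is an edge-to-edge tiling of the Euclidean plane $\mathbb{R}^2$ by regular polygons whose symmetry group has exactly two orbits on the set of vertices; viewed as a map on the plane, its vertices have (at most) two types, listed as $[W;Z]$. (Up to isomorphism there are exactly $20$ such tilings; there is exactly one with the vertex types named in the claim.) For a map $K$ on the plane, a quotient of $K$ on the torus is a map $X$ on the torus together with a polyhedral covering map $\eta:K\to X$ with $X=K/\Gamma$, where $\Gamma\le {\rm Aut}(K)$ is a subgroup acting without fixed vertices, edges or faces and $K/\Gamma$ is homeomorphic to the torus. ${\rm Aut}(X)$ denotes the automorphism group of the map $X$, acting on its vertex set $V(X)$. *)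

theory Defs
  imports Main
begin

text \<open>
  The triangular lattice is modelled as int \<times> int, the point (a,b) standing for
  a + b*w with w = exp(i*pi/3).  The six lattice neighbours of a point, in
  counter-clockwise order, differ from it by (1,0),(0,1),(-1,1),(-1,0),(0,-1),(1,-1).

  The 2-uniform tiling K of type [3^4.6; 3^2.6^2] is obtained from the regular
  triangle tiling by merging, around every centre c (the points with
  a - b = 0 mod 5), the six triangles at c into a regular hexagon.
  Points with a-b = 1,4 (mod 5) get type [3^2,6^2], points with a-b = 2,3 (mod 5)
  get type [3^4,6^1].
\<close>

type_synonym pt = "int \<times> int"

definition centre :: "pt \<Rightarrow> bool" where
  "centre p \<longleftrightarrow> (fst p - snd p) mod 5 = 0"

definition dir :: "nat \<Rightarrow> pt" where
  "dir i = [(1,0),(0,1),(-1,1),(-1,0),(0,-1),(1,-1)] ! (i mod 6)"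

definition padd :: "pt \<Rightarrow> pt \<Rightarrow> pt" where
  "padd p q = (fst p + fst q, snd p + snd q)"

definition adj :: "pt \<Rightarrow> pt \<Rightarrow> bool" where
  "adj p q \<longleftrightarrow> (\<exists>i<6. q = padd p (dir i))"

definition KV :: "pt set" where
  "KV = {p. \<not> centre p}"

definition KE :: "pt set set" where
  "KE = {{p, q} | p q. p \<in> KV \<and> q \<in> KV \<and> adj p q}"

text \<open>Faces of K, each given by its counter-clockwise set of darts (directed
  boundary edges).\<close>

definition upD :: "int \<Rightarrow> int \<Rightarrow> (pt \<times> pt) set" where
  "upD a b = {((a,b),(a+1,b)), ((a+1,b),(a,b+1)), ((a,b+1),(a,b))}"

definition downD :: "int \<Rightarrow> int \<Rightarrow> (pt \<times> pt) set" where
  "downD a b = {((a+1,b),(a+1,b+1)), ((a+1,b+1),(a,b+1)), ((a,b+1),(a+1,b))}"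

definition hexD :: "pt \<Rightarrow> (pt \<times> pt) set" where
  "hexD c = {(padd c (dir i), padd c (dir (Suc i))) | i. i < 6}"

definition KFD :: "(pt \<times> pt) set set" where
  "KFD = {upD a b | a b. fst ` upD a b \<subseteq> KV}
       \<union> {downD a b | a b. fst ` downD a b \<subseteq> KV}
       \<union> {hexD c | c. centre c}"

definition KF :: "pt set set" where
  "KF = (\<lambda>D. fst ` D) ` KFD"

text \<open>Automorphisms of the map K (acting on vertices; extended by the identity
  outside the vertex set so that they form a group of permutations).\<close>

definition autK :: "(pt \<Rightarrow> pt) \<Rightarrow> bool" where
  "autK f \<longleftrightarrow> bij_betw f KV KV \<and> (\<forall>x. x \<notin> KV \<longrightarrow> f x = x)
     \<and> (\<forall>e. e \<subseteq> KV \<longrightarrow> (e \<in> KE \<longleftrightarrow> f ` e \<in> KE))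
     \<and> (\<forall>F. F \<subseteq> KV \<longrightarrow> (F \<in> KF \<longleftrightarrow> f ` F \<in> KF))"

definition free_subgroup :: "(pt \<Rightarrow> pt) set \<Rightarrow> bool" where
  "free_subgroup G \<longleftrightarrow> (\<forall>g\<in>G. autK g) \<and> id \<in> G
     \<and> (\<forall>g\<in>G. \<forall>h\<in>G. g \<circ> h \<in> G) \<and> (\<forall>g\<in>G. inv g \<in> G)
     \<and> (\<forall>g\<in>G. g \<noteq> id \<longrightarrow>
          (\<forall>v\<in>KV. g v \<noteq> v) \<and> (\<forall>e\<in>KE. g ` e \<noteq> e) \<and> (\<forall>F\<in>KF. g ` F \<noteq> F))"

definition vorb :: "(pt \<Rightarrow> pt) set \<Rightarrow> pt \<Rightarrow> pt set" where
  "vorb G v = (\<lambda>g. g v) ` G"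

definition sorb :: "(pt \<Rightarrow> pt) set \<Rightarrow> pt set \<Rightarrow> pt set set" where
  "sorb G S = (\<lambda>g. g ` S) ` G"

definition XV :: "(pt \<Rightarrow> pt) set \<Rightarrow> pt set set" where
  "XV G = vorb G ` KV"

definition XE :: "(pt \<Rightarrow> pt) set \<Rightarrow> pt set set set" where
  "XE G = sorb G ` KE"

definition XF :: "(pt \<Rightarrow> pt) set \<Rightarrow> pt set set set" where
  "XF G = sorb G ` KF"

definition XEV :: "(pt \<Rightarrow> pt) set \<Rightarrow> pt set set set" where
  "XEV G = (\<lambda>e. vorb G ` e) ` KE"

definition XFV :: "(pt \<Rightarrow> pt) set \<Rightarrow> pt set set set" where
  "XFV G = (\<lambda>F. vorb G ` F) ` KF"

definition face_edges_X :: "(pt \<Rightarrow> pt) set \<Rightarrow> pt set \<Rightarrow> pt set set set" where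
  "face_edges_X G F = sorb G ` {e \<in> KE. e \<subseteq> F}"

definition polyhedral_X :: "(pt \<Rightarrow> pt) set \<Rightarrow> bool" where
  "polyhedral_X G \<longleftrightarrow> (\<forall>F\<in>KF. \<forall>F'\<in>KF. sorb G F \<noteq> sorb G F' \<longrightarrow>
     (let I = vorb G ` F \<inter> vorb G ` F'; J = face_edges_X G F \<inter> face_edges_X G F'
      in I = {} \<or> (\<exists>x. I = {x} \<and> J = {}) \<or> (\<exists>e\<in>KE. J = {sorb G e} \<and> I = vorb G ` e)))"

text \<open>Orientability of X: the faces of X can be oriented coherently.  An orientation
  of a face of X is described on its lifts: sigma D says whether the lift D is
  oriented counter-clockwise; it must be compatible with G (so it is an orientation of
  the face of X), and coherent (no dart of X is used by two oriented faces).\<close>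

definition ori :: "((pt \<times> pt) set \<Rightarrow> bool) \<Rightarrow> (pt \<times> pt) set \<Rightarrow> (pt \<times> pt) set" where
  "ori \<sigma> D = (if \<sigma> D then D else converse D)"

definition orientable_X :: "(pt \<Rightarrow> pt) set \<Rightarrow> bool" where
  "orientable_X G \<longleftrightarrow> (\<exists>\<sigma>.
     (\<forall>g\<in>G. \<forall>D\<in>KFD. \<forall>D'\<in>KFD. fst ` D' = g ` fst ` D \<longrightarrow> map_prod g g ` ori \<sigma> D = ori \<sigma> D')
     \<and> (\<forall>D1\<in>KFD. \<forall>D2\<in>KFD. \<forall>g\<in>G. \<forall>d. d \<in> ori \<sigma> D1 \<and> map_prod g g d \<in> ori \<sigma> D2
          \<longrightarrow> fst ` D2 = g ` fst ` D1))"

text \<open>K/G is homeomorphic to the torus: it is a closed (finite), orientable surface of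
  Euler characteristic 0.\<close>

definition torus_quotient :: "(pt \<Rightarrow> pt) set \<Rightarrow> bool" where
  "torus_quotient G \<longleftrightarrow> finite (XV G) \<and> finite (XE G) \<and> finite (XF G)
     \<and> int (card (XV G)) - int (card (XE G)) + int (card (XF G)) = 0
     \<and> orientable_X G"

definition autX :: "(pt \<Rightarrow> pt) set \<Rightarrow> (pt set \<Rightarrow> pt set) \<Rightarrow> bool" where
  "autX G \<alpha> \<longleftrightarrow> bij_betw \<alpha> (XV G) (XV G)
     \<and> bij_betw (\<lambda>S. \<alpha> ` S) (XEV G) (XEV G)
     \<and> bij_betw (\<lambda>S. \<alpha> ` S) (XFV G) (XFV G)"

definition autX_orbits :: "(pt \<Rightarrow> pt) set \<Rightarrow> pt set set set" where
  "autX_orbits G = (\<lambda>x. {\<alpha> x | \<alpha>. autX G \<alpha>}) ` XV G"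

end

theory Submission
  imports Defs
begin

text \<open>
  Coherence of the orientation forces every deck transformation to preserve the counter-clockwise
  darts of all faces, because the faces of K are connected through shared edges.  A map of the
  darts is determined by its value on one dart; since a hexagon shares only two opposite edges
  with other hexagons, it is a translation or a half turn.  A half turn fixes an edge or a face,
  so G consists of translations.  Hence all translations and half turns of K normalise G and
  descend to X.  They have only two orbits on the vertices of K.
\<close>

section \<open>Lattice coordinates and the faces of \<open>K\<close>\<close>

lemma dir_simps [simp]:
  "dir 0 = (1,0)" "dir (Suc 0) = (0,1)" "dir 2 = (-1,1)" "dir 3 = (-1,0)"
  "dir 4 = (0,-1)" "dir 5 = (1,-1)" "dir 6 = (1,0)"
  by (simp_all add: dir_def)

lemma ex_less_6: "(\<exists>i<6. P i) \<longleftrightarrow> P 0 \<or> P (Suc 0) \<or> P 2 \<or> P 3 \<or> P 4 \<or> P (5::nat)"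
proof -
  have "i < 6 \<longleftrightarrow> i = 0 \<or> i = Suc 0 \<or> i = 2 \<or> i = 3 \<or> i = 4 \<or> i = 5" for i :: nat
    by linarith
  then show ?thesis by (simp add: conj_disj_distribR ex_disj_distrib)
qed

lemma hexD_eq: "hexD (x,y) = {((x+1,y),(x,y+1)), ((x,y+1),(x-1,y+1)), ((x-1,y+1),(x-1,y)),
   ((x-1,y),(x,y-1)), ((x,y-1),(x+1,y-1)), ((x+1,y-1),(x+1,y))}"
proof -
  have "hexD c = {d. \<exists>i<6. d = (padd c (dir i), padd c (dir (Suc i)))}" for c
    unfolding hexD_def by blast
  moreover have "Suc (Suc 0) = 2" "Suc 2 = 3" "Suc 3 = 4" "Suc 4 = 5" "Suc 5 = 6" by simp_all
  ultimately show ?thesis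
    by (simp only: ex_less_6) (auto simp: padd_def)
qed

lemma adj_eq: "adj (a,b) q \<longleftrightarrow> q \<in> {(a+1,b),(a,b+1),(a-1,b+1),(a-1,b),(a,b-1),(a+1,b-1)}"
  unfolding adj_def ex_less_6 by (simp add: padd_def)

lemma centre_eq: "centre (a,b) \<longleftrightarrow> 5 dvd (a - b)"
  by (auto simp: centre_def dvd_eq_mod_eq_0)

lemma KV_eq: "(a,b) \<in> KV \<longleftrightarrow> \<not> 5 dvd (a - b)"
  by (simp add: KV_def centre_eq)

lemma KFD_cases:
  assumes "D \<in> KFD"
  obtains (up) a b where "D = upD a b" "(a,b) \<in> KV" "(a+1,b) \<in> KV" "(a,b+1) \<in> KV"
    | (down) a b where "D = downD a b" "(a+1,b) \<in> KV" "(a+1,b+1) \<in> KV" "(a,b+1) \<in> KV"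
    | (hex) x y where "D = hexD (x,y)" "centre (x,y)"
  using assms unfolding KFD_def by (fastforce simp: upD_def downD_def)

lemma upD_in: "(a,b) \<in> KV \<Longrightarrow> (a+1,b) \<in> KV \<Longrightarrow> (a,b+1) \<in> KV \<Longrightarrow> upD a b \<in> KFD"
  unfolding KFD_def by (auto simp: upD_def)

lemma downD_in: "(a+1,b) \<in> KV \<Longrightarrow> (a+1,b+1) \<in> KV \<Longrightarrow> (a,b+1) \<in> KV \<Longrightarrow> downD a b \<in> KFD"
  unfolding KFD_def by (auto simp: downD_def)

lemma hexD_in: "centre c \<Longrightarrow> hexD c \<in> KFD"
  unfolding KFD_def by blast

lemma face_subset_KV: "D \<in> KFD \<Longrightarrow> fst ` D \<subseteq> KV"
  by (erule KFD_cases) (auto simp: upD_def downD_def hexD_eq centre_eq KV_eq, presburger+)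

text \<open>This is p + w(q - p) with w = exp(i*pi/3): the third corner of the lattice triangle to
  the left of the dart from \<open>p\<close> to \<open>q\<close>.\<close>

definition apex :: "pt \<Rightarrow> pt \<Rightarrow> pt" where
  "apex p q = (fst p + snd p - snd q, snd q + fst q - fst p)"

text \<open>The face to the left of a dart can be read off from the dart: the apex is either a
  hexagon centre or the third corner of a triangle. Hence no dart lies on two faces.\<close>

lemma face_of_dart:
  assumes "D \<in> KFD" "(p,q) \<in> D"
  shows "D = (if centre (apex p q) then hexD (apex p q)
              else {(p,q), (q, apex p q), (apex p q, p)})"
  using assms(1)
proof (cases rule: KFD_cases)
  case (up a b)
  then show ?thesis using assms(2) unfolding up(1) upD_def
    by (elim insertE emptyE) (simp_all add: KV_def apex_def algebra_simps insert_commute)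
next
  case (down a b)
  then show ?thesis using assms(2) unfolding down(1) downD_def
    by (elim insertE emptyE) (simp_all add: KV_def apex_def algebra_simps insert_commute)
next
  case (hex x y)
  have "apex p q = (x,y)" using assms(2) unfolding hex(1) by (auto simp: hexD_eq apex_def)
  then show ?thesis using hex by simp
qed

lemma face_unique: "D \<in> KFD \<Longrightarrow> D' \<in> KFD \<Longrightarrow> d \<in> D \<Longrightarrow> d \<in> D' \<Longrightarrow> D = D'"
  by (cases d) (metis face_of_dart)

text \<open>The number of corners and the two coordinate sums identify a face: the number separates
  hexagons from triangles, the sums modulo 3 separate up from down, and the sums themselves recover
  the position.\<close>

lemma upD_invariants: "card (fst ` upD a b) = 3" "sum fst (fst ` upD a b) = 3*a+1" "sum snd (fst ` upD a b) = 3*b+1" 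
  by (simp_all add: upD_def)
lemma downD_invariants: "card (fst ` downD a b) = 3" "sum fst (fst ` downD a b) = 3*a+2" "sum snd (fst ` downD a b) = 3*b+2" 
  by (simp_all add: downD_def)
lemma hexD_invariants: "card (fst ` hexD (a,b)) = 6" "sum fst (fst ` hexD (a,b)) = 6*a" "sum snd (fst ` hexD (a,b)) = 6*b" 
  by (simp_all add: hexD_eq)
lemma face_eqI:
  assumes "D \<in> KFD" "D' \<in> KFD" "fst ` D = fst ` D'"
  shows "D = D'"
proof -
  have eq: "card (fst ` D) = card (fst ` D')" "sum fst (fst ` D) = sum fst (fst ` D')"
    "sum snd (fst ` D) = sum snd (fst ` D')" using assms(3) by simp_all
  from assms(1) show ?thesis
  proof (cases rule: KFD_cases)
    case (up a b)
    from assms(2) show ?thesis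
      by (cases rule: KFD_cases) (use eq up in \<open>auto simp: upD_invariants downD_invariants hexD_invariants; presburger\<close>)+
  next
    case (down a b)
    from assms(2) show ?thesis
      by (cases rule: KFD_cases) (use eq down in \<open>auto simp: upD_invariants downD_invariants hexD_invariants; presburger\<close>)+
  next
    case (hex a b)
    from assms(2) show ?thesis
      by (cases rule: KFD_cases) (use eq hex in \<open>auto simp: upD_invariants downD_invariants hexD_invariants\<close>)+
  qed
qed

lemma face_no_reverse: "D \<in> KFD \<Longrightarrow> (x,y) \<in> D \<Longrightarrow> (y,x) \<notin> D"
  by (erule KFD_cases) (auto simp: upD_def downD_def hexD_eq)

section \<open>Connectedness of the faces through shared edges\<close>

text \<open>The centres form the lattice generated by (1,1) and (3,-2), of index 5 in the plane
  lattice. Equivalences in the hypotheses allow steps along each generator in both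
  directions.\<close>

lemma centre_induct:
  assumes "P (0,0)"
    and "\<And>x y. centre (x,y) \<Longrightarrow> P (x,y) \<longleftrightarrow> P (x+1,y+1)"
    and "\<And>x y. centre (x,y) \<Longrightarrow> P (x,y) \<longleftrightarrow> P (x+3,y-2)"
    and "centre c"
  shows "P c"
proof -
  have 1: "P (i,i)" for i
  proof (induction i rule: int_induct[where k = 0])
    case base
    show ?case by (rule assms(1))
  next
    case (step1 i)
    then show ?case using assms(2)[of i i] by (simp add: centre_eq)
  next
    case (step2 i)
    then show ?case using assms(2)[of "i-1" "i-1"] by (simp add: centre_eq)
  qed
  have 2: "P (i + 3*k, i - 2*k)" for i k
  proof (induction k rule: int_induct[where k = 0])
    case base
    then show ?case using 1 by simp
  next
    case (step1 k)
    have "centre (i + 3*k, i - 2*k)" by (simp add: centre_eq)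
    from assms(3)[OF this] step1 show ?case by (simp add: algebra_simps)
  next
    case (step2 k)
    have "centre (i + 3*(k-1), i - 2*(k-1))" by (simp add: centre_eq)
    from assms(3)[OF this] step2 show ?case by (simp add: algebra_simps)
  qed
  obtain x y where c: "c = (x,y)" by (cases c)
  then obtain k where "x - y = 5 * k" using assms(4) by (auto simp: centre_eq)
  then show ?thesis using 2[of "x - 3*k" k] c by (simp add: algebra_simps)
qed

text \<open>Two counter-clockwise faces traverse a common edge in opposite directions, which is how
  \<open>step\<close> expresses adjacency. Hexagons are linked first, then each triangle is linked
  to a hexagon.\<close>

lemma face_connected:
  assumes step: "\<And>D1 D2 x y. D1 \<in> KFD \<Longrightarrow> D2 \<in> KFD \<Longrightarrow> (x,y) \<in> D1 \<Longrightarrow> (y,x) \<in> D2 \<Longrightarrow> P D1 \<Longrightarrow> P D2"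
    and base: "P (hexD (0,0))" and D: "D \<in> KFD"
  shows "P D"
proof -
  have sym: "P D1 \<longleftrightarrow> P D2" if "D1 \<in> KFD" "D2 \<in> KFD" "(x,y) \<in> D1" "(y,x) \<in> D2" for D1 D2 x y
    using step that by blast
  have hu: "P (hexD (a-1,b+1)) \<longleftrightarrow> P (upD a b)" and hu_in: "upD a b \<in> KFD"
    if "5 dvd (a - b - 2)" for a b
  proof -
    show u: "upD a b \<in> KFD" by (rule upD_in) (use that in \<open>simp_all add: KV_eq, presburger+\<close>)
    have "centre (a-1,b+1)" using that by (simp add: centre_eq algebra_simps)
    from sym[OF hexD_in[OF this] u, of "(a,b)" "(a,b+1)"]
    show "P (hexD (a-1,b+1)) \<longleftrightarrow> P (upD a b)" by (simp add: hexD_eq upD_def)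
  qed
  have hd: "P (hexD (a+2,b)) \<longleftrightarrow> P (downD a b)" and hd_in: "downD a b \<in> KFD"
    if "5 dvd (a - b - 3)" for a b
  proof -
    show d: "downD a b \<in> KFD" by (rule downD_in) (use that in \<open>simp_all add: KV_eq, presburger+\<close>)
    have "centre (a+2,b)" using that by (simp add: centre_eq) presburger
    from sym[OF hexD_in[OF this] d, of "(a+1,b+1)" "(a+1,b)"]
    show "P (hexD (a+2,b)) \<longleftrightarrow> P (downD a b)" by (simp add: hexD_eq downD_def)
  qed
  have ud: "P (upD a b) \<longleftrightarrow> P (downD a b)" if "upD a b \<in> KFD" "downD a b \<in> KFD" for a b
    using sym[OF that, of "(a+1,b)" "(a,b+1)"] by (simp add: upD_def downD_def)
  have hex: "P (hexD c)" if "centre c" for c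
    using base _ _ that
  proof (rule centre_induct)
    fix x y :: int assume c: "centre (x,y)"
    then have c': "centre (x+1,y+1)" by (simp add: centre_eq)
    \<comment> \<open>Hexagons whose centres differ by (1,1) share an edge; those differing by
      (3,-2) are joined below through an up and a down triangle.\<close>
    show "P (hexD (x,y)) \<longleftrightarrow> P (hexD (x+1,y+1))"
      using sym[OF hexD_in[OF c] hexD_in[OF c'], of "(x+1,y)" "(x,y+1)"] by (simp add: hexD_eq)
    have u: "5 dvd (x + 1 - (y - 1) - 2)" and d: "5 dvd (x + 1 - (y - 2) - 3)"
      using c by (simp_all add: centre_eq)
    have "P (upD (x+1) (y-1)) \<longleftrightarrow> P (downD (x+1) (y-2))"
      using sym[OF hu_in[OF u] hd_in[OF d], of "(x+1,y-1)" "(x+2,y-1)"]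
      by (simp add: upD_def downD_def)
    with hu[OF u] hd[OF d] show "P (hexD (x,y)) \<longleftrightarrow> P (hexD (x+3,y-2))"
      by (simp add: algebra_simps)
  qed
  show ?thesis
    using D
  proof (cases rule: KFD_cases)
    case (up a b)
    \<comment> \<open>The other residues of a - b would make a corner of the triangle a centre. With
      residue 3 the path to a hexagon goes through the down triangle across the slanted
      edge.\<close>
    have "5 dvd (a - b - 2) \<or> 5 dvd (a - b - 3)"
      using up(2-) unfolding KV_eq by presburger
    then consider "5 dvd (a - b - 2)" | "5 dvd (a - b - 3)" by blast
    then show ?thesis
    proof cases
      case 1
      then have "centre (a-1,b+1)" by (simp add: centre_eq algebra_simps)
      with hu[OF 1] hex up show ?thesis by simp
    next
      case 2
      then have "centre (a+2,b)" by (simp add: centre_eq) presburger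
      with hd[OF 2] hex ud hd_in[OF 2] up D show ?thesis by simp
    qed
  next
    case (down a b)
    have "5 dvd (a - b - 2) \<or> 5 dvd (a - b - 3)"
      using down(2-) unfolding KV_eq by presburger
    then consider "5 dvd (a - b - 2)" | "5 dvd (a - b - 3)" by blast
    then show ?thesis
    proof cases
      case 1
      then have "centre (a-1,b+1)" by (simp add: centre_eq algebra_simps)
      with hu[OF 1] hex ud hu_in[OF 1] down D show ?thesis by simp
    next
      case 2
      then have "centre (a+2,b)" by (simp add: centre_eq) presburger
      with hd[OF 2] hex down show ?thesis by simp
    qed
  next
    case (hex x y)
    then show ?thesis using \<open>\<And>c. centre c \<Longrightarrow> P (hexD c)\<close> by simp
  qed
qed

section \<open>Translations and half turns of \<open>K\<close>\<close>

text \<open>Used with \<open>e\<close> equal to 1 or -1: the translation by \<open>s\<close>, or the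
  half turn about s/2. One formula lets both be treated together.\<close>

definition aff :: "int \<Rightarrow> pt \<Rightarrow> pt \<Rightarrow> pt" where
  "aff e s p = (e * fst p + fst s, e * snd p + snd s)"

lemma aff_KV:
  assumes "e = 1 \<or> e = -1" "centre s" "p \<in> KV" shows "aff e s p \<in> KV"
  using assms by (cases p; cases s) (auto simp: aff_def KV_eq centre_eq; presburger)

lemma aff_face:
  assumes e: "e = 1 \<or> e = -1" and s: "centre s" and D: "D \<in> KFD"
  shows "map_prod (aff e s) (aff e s) ` D \<in> KFD"
proof -
  obtain s1 s2 where s': "s = (s1,s2)" by (cases s)
  note KV = aff_KV[OF e s]
  show ?thesis
    using D
  proof (cases rule: KFD_cases)
    case (up a b)
    note v = KV[OF up(2)] KV[OF up(3)] KV[OF up(4)]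
    show ?thesis using e
    proof
      assume e1: "e = 1"
      have "map_prod (aff e s) (aff e s) ` D = upD (a + s1) (b + s2)"
        using e1 up(1) s' by (auto simp: upD_def aff_def algebra_simps)
      moreover have "upD (a + s1) (b + s2) \<in> KFD"
        by (rule upD_in) (use v e1 s' in \<open>simp_all add: aff_def algebra_simps\<close>)
      ultimately show ?thesis by simp
    next
      assume e1: "e = -1"
      \<comment> \<open>A half turn exchanges up and down triangles. The shift by 1 arises because
        (a,b) goes to the corner (a'+1,b'+1) of \<open>downD a' b'\<close>.\<close>
      have "map_prod (aff e s) (aff e s) ` D = downD (s1 - a - 1) (s2 - b - 1)"
        using e1 up(1) s' by (auto simp: upD_def downD_def aff_def algebra_simps)
      moreover have "downD (s1 - a - 1) (s2 - b - 1) \<in> KFD"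
        by (rule downD_in) (use v e1 s' in \<open>simp_all add: aff_def algebra_simps\<close>)
      ultimately show ?thesis by simp
    qed
  next
    case (down a b)
    note v = KV[OF down(2)] KV[OF down(3)] KV[OF down(4)]
    show ?thesis using e
    proof
      assume e1: "e = 1"
      have "map_prod (aff e s) (aff e s) ` D = downD (a + s1) (b + s2)"
        using e1 down(1) s' by (auto simp: downD_def aff_def algebra_simps)
      moreover have "downD (a + s1) (b + s2) \<in> KFD"
        by (rule downD_in) (use v e1 s' in \<open>simp_all add: aff_def algebra_simps\<close>)
      ultimately show ?thesis by simp
    next
      assume e1: "e = -1"
      have "map_prod (aff e s) (aff e s) ` D = upD (s1 - a - 1) (s2 - b - 1)"
        using e1 down(1) s' by (auto simp: upD_def downD_def aff_def algebra_simps)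
      moreover have "upD (s1 - a - 1) (s2 - b - 1) \<in> KFD"
        by (rule upD_in) (use v e1 s' in \<open>simp_all add: aff_def algebra_simps\<close>)
      ultimately show ?thesis by simp
    qed
  next
    case (hex x y)
    have "map_prod (aff e s) (aff e s) ` D = hexD (e*x + s1, e*y + s2)"
      using e hex(1) s' by (elim disjE) (simp_all add: hexD_eq aff_def algebra_simps insert_commute)
    moreover have "centre (e*x + s1, e*y + s2)"
      using e hex(2) s s' by (auto simp: centre_eq; presburger)
    ultimately show ?thesis using hexD_in by simp
  qed
qed

text \<open>Since e*e = 1, the inverse has the same sign \<open>e\<close> and translation part -e*s;
  it recurs below under the name \<open>t\<close>.\<close>

lemma aff_inverse:
  assumes "e = 1 \<or> e = -1"
  shows "aff e s (aff e (-e * fst s, -e * snd s) p) = p" "aff e (-e * fst s, -e * snd s) (aff e s p) = p"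
  using assms by (auto simp: aff_def algebra_simps)

lemma centre_inverse: "centre s \<Longrightarrow> centre (- e * fst s, - e * snd s)"
proof -
  assume "centre s"
  then have "5 dvd - e * (fst s - snd s)" by (cases s) (simp add: centre_eq)
  then show ?thesis by (simp add: centre_eq algebra_simps)
qed

section \<open>Rigidity of maps preserving counter-clockwise faces\<close>

lemma face_functional: "D \<in> KFD \<Longrightarrow> (x,y) \<in> D \<Longrightarrow> (x,z) \<in> D \<Longrightarrow> y = z"
  by (erule KFD_cases) (auto simp: upD_def downD_def hexD_eq)

text \<open>The image face shares a dart with \<open>D\<close>, so it is \<open>D\<close>. As every
  corner has one successor on \<open>D\<close>, fixedness travels around the boundary.\<close>

lemma face_fixed:
  assumes D: "D \<in> KFD" "map_prod h h ` D \<in> KFD" and d: "(x,y) \<in> D" "h x = x" "h y = y"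
    and p: "p \<in> fst ` D"
  shows "h p = p"
proof -
  have "map_prod h h (x,y) \<in> map_prod h h ` D" using d(1) by blast
  then have eq: "map_prod h h ` D = D" using face_unique[OF D(2) D(1)] d by simp
  have next_fixed: "h r = r" if "(q,r) \<in> D" "h q = q" for q r
  proof -
    have "map_prod h h (q,r) \<in> D" using that(1) eq by blast
    then show ?thesis using face_functional[OF D(1), of q r "h r"] that by simp
  qed
  from D(1) show ?thesis
  proof (cases rule: KFD_cases)
    case (up a b)
    have "h (a,b) = (a,b) \<Longrightarrow> h (a+1,b) = (a+1,b)" "h (a+1,b) = (a+1,b) \<Longrightarrow> h (a,b+1) = (a,b+1)"
      "h (a,b+1) = (a,b+1) \<Longrightarrow> h (a,b) = (a,b)"
      using next_fixed unfolding up(1) upD_def by blast+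
    then show ?thesis using d p unfolding up(1) upD_def by auto
  next
    case (down a b)
    have "h (a+1,b) = (a+1,b) \<Longrightarrow> h (a+1,b+1) = (a+1,b+1)"
      "h (a+1,b+1) = (a+1,b+1) \<Longrightarrow> h (a,b+1) = (a,b+1)"
      "h (a,b+1) = (a,b+1) \<Longrightarrow> h (a+1,b) = (a+1,b)"
      using next_fixed unfolding down(1) downD_def by blast+
    then show ?thesis using d p unfolding down(1) downD_def by auto
  next
    case (hex a b)
    have "h (a+1,b) = (a+1,b) \<Longrightarrow> h (a,b+1) = (a,b+1)"
      "h (a,b+1) = (a,b+1) \<Longrightarrow> h (a-1,b+1) = (a-1,b+1)"
      "h (a-1,b+1) = (a-1,b+1) \<Longrightarrow> h (a-1,b) = (a-1,b)"
      "h (a-1,b) = (a-1,b) \<Longrightarrow> h (a,b-1) = (a,b-1)"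
      "h (a,b-1) = (a,b-1) \<Longrightarrow> h (a+1,b-1) = (a+1,b-1)"
      "h (a+1,b-1) = (a+1,b-1) \<Longrightarrow> h (a+1,b) = (a+1,b)"
      using next_fixed unfolding hex(1) hexD_eq by blast+
    then show ?thesis using d p unfolding hex(1) hexD_eq by auto
  qed
qed

lemma KV_in_hexD:
  assumes "p \<in> KV"
  obtains c where "centre c" "p \<in> fst ` hexD c"
proof -
  obtain a b where p: "p = (a,b)" by (cases p)
  have "5 dvd a - 1 - b \<or> 5 dvd a + 1 - b \<or> 5 dvd a - 1 - (b + 1) \<or> 5 dvd a + 1 - (b - 1)"
    using assms unfolding p KV_eq by presburger
  then consider "5 dvd a - 1 - b" | "5 dvd a + 1 - b" | "5 dvd a - 1 - (b + 1)" | "5 dvd a + 1 - (b - 1)"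
    by blast
  then show thesis
  proof cases
    case 1 then show ?thesis using that[of "(a-1,b)"] p by (simp add: centre_eq hexD_eq)
  next
    case 2 then show ?thesis using that[of "(a+1,b)"] p by (simp add: centre_eq hexD_eq)
  next
    case 3 then show ?thesis using that[of "(a-1,b+1)"] p by (simp add: centre_eq hexD_eq)
  next
    case 4 then show ?thesis using that[of "(a+1,b-1)"] p by (simp add: centre_eq hexD_eq)
  qed
qed

text \<open>Fixing all corners of a face fixes both ends of each of its edges, hence all corners of
  the adjacent faces; connectedness spreads this from the hexagon at the origin.\<close>

lemma face_map_rigid:
  assumes faces: "\<And>D. D \<in> KFD \<Longrightarrow> map_prod h h ` D \<in> KFD"
    and dart: "h (1,0) = (1,0)" "h (0,1) = (0,1)"
    and p: "p \<in> KV"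
  shows "h p = p"
proof -
  have c0: "centre (0,0)" by (simp add: centre_eq)
  have "\<forall>p\<in>fst ` D. h p = p" if "D \<in> KFD" for D
    using _ _ that
  proof (rule face_connected)
    fix D1 D2 x y
    assume D: "D1 \<in> KFD" "D2 \<in> KFD" "(x,y) \<in> D1" "(y,x) \<in> D2" "\<forall>p\<in>fst ` D1. h p = p"
    have "x \<in> fst ` D2" "h x = x" "h y = y"
    proof -
      show "h x = x" using D(3,5) by force
      have "y \<in> fst ` D1 \<and> x \<in> fst ` D2"
        using D(1-4) by (auto elim!: KFD_cases simp: upD_def downD_def hexD_eq)
      then show "x \<in> fst ` D2" "h y = y" using D(5) by auto
    qed
    then show "\<forall>p\<in>fst ` D2. h p = p" using face_fixed[OF D(2) faces[OF D(2)] D(4)] by blast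
  next
    have "((1,0),(0,1)) \<in> hexD (0,0)" by (simp add: hexD_eq)
    then show "\<forall>p\<in>fst ` hexD (0,0). h p = p"
      using face_fixed[OF hexD_in[OF c0] faces[OF hexD_in[OF c0]]] dart by blast
  qed
  moreover obtain c where "centre c" "p \<in> fst ` hexD c" using p by (rule KV_in_hexD)
  ultimately show ?thesis using hexD_in by blast
qed

lemma face_map_hexD:
  assumes faces: "\<And>D. D \<in> KFD \<Longrightarrow> map_prod g g ` D \<in> KFD" and inj: "inj_on g KV"
    and c: "centre c"
  obtains c' where "centre c'" "map_prod g g ` hexD c = hexD c'"
proof -
  note D = hexD_in[OF c]
  have "fst ` map_prod g g ` hexD c = g ` fst ` hexD c" by force
  moreover have "card (g ` fst ` hexD c) = 6"
    using card_image[OF inj_on_subset[OF inj face_subset_KV[OF D]]]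
    by (cases c) (simp add: hexD_invariants)
  ultimately have "card (fst ` map_prod g g ` hexD c) = 6" by simp
  with faces[OF D] show thesis
    by (elim KFD_cases) (auto simp: upD_invariants downD_invariants intro: that)
qed

text \<open>The images of the adjacent hexagons at (0,0) and (1,1) determine \<open>g\<close> up to
  sign on their common edge. Composing with the inverse of the matching \<open>aff e s\<close> gives
  a map to which rigidity applies.\<close>

lemma face_map_aff:
  assumes faces: "\<And>D. D \<in> KFD \<Longrightarrow> map_prod g g ` D \<in> KFD" and inj: "inj_on g KV"
  obtains e s where "e = 1 \<or> e = -1" "centre s" "\<And>p. p \<in> KV \<Longrightarrow> g p = aff e s p"
proof -
  have "centre (0,0)" "centre (1,1)" by (simp_all add: centre_eq)
  then obtain s s' where s: "centre s" "map_prod g g ` hexD (0,0) = hexD s"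
    and s': "centre s'" "map_prod g g ` hexD (1,1) = hexD s'"
    using face_map_hexD[OF faces inj] by metis
  obtain u v u' v' where uv: "s = (u,v)" "s' = (u',v')" by (cases s; cases s')
  have "((1,0),(0,1)) \<in> hexD (0,0)" "((0,1),(1,0)) \<in> hexD (1,1)" by (simp_all add: hexD_eq)
  then have "map_prod g g ((1,0),(0,1)) \<in> hexD s" "map_prod g g ((0,1),(1,0)) \<in> hexD s'"
    using s s' by blast+
  then have darts: "(g (1,0), g (0,1)) \<in> hexD (u,v)" "(g (0,1), g (1,0)) \<in> hexD (u',v')"
    using uv by simp_all
  \<comment> \<open>Only two opposite edges of a hexagon are shared with another hexagon.\<close>
  have "g (1,0) = (u+1,v) \<and> g (0,1) = (u,v+1) \<or> g (1,0) = (u-1,v) \<and> g (0,1) = (u,v-1)"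
  proof -
    \<comment> \<open>The apex of the reversed dart is the centre of the neighbouring hexagon; four
      of the six darts of \<open>hexD s\<close> have a reversed apex that is not a centre.\<close>
    have "apex (g (0,1)) (g (1,0)) = s'"
      using darts(2) uv by (auto simp: hexD_eq apex_def)
    with s'(1) have "centre (apex (g (0,1)) (g (1,0)))" by simp
    then show ?thesis
      using darts(1) s(1) uv by (auto simp: hexD_eq apex_def centre_eq; presburger)
  qed
  then obtain e where e: "e = 1 \<or> e = -1" "g (1,0) = aff e s (1,0)" "g (0,1) = aff e s (0,1)"
    unfolding aff_def uv by force
  define t where "t = (- e * fst s, - e * snd s)"
  have t: "centre t" unfolding t_def by (rule centre_inverse[OF s(1)])
  have "aff e t (g p) = p" if "p \<in> KV" for p
  proof (rule face_map_rigid[OF _ _ _ that])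
    fix D assume "D \<in> KFD"
    then have "map_prod (aff e t) (aff e t) ` map_prod g g ` D \<in> KFD"
      by (intro aff_face e t faces)
    then show "map_prod (\<lambda>p. aff e t (g p)) (\<lambda>p. aff e t (g p)) ` D \<in> KFD"
      by (simp add: image_image map_prod_def case_prod_unfold)
  qed (use e aff_inverse(2)[OF e(1)] in \<open>simp_all add: t_def\<close>)
  then have "g p = aff e s p" if "p \<in> KV" for p
    using aff_inverse(1)[OF e(1), of s "g p"] that by (simp add: t_def)
  then show thesis using that e s by blast
qed

section \<open>Deck transformations are translations\<close>

lemma autK_inj:
  assumes "autK g" shows "inj g"
proof -
  have "g ` KV = KV" "inj_on g KV" "\<And>x. x \<notin> KV \<Longrightarrow> g x = x"
    using assms unfolding autK_def bij_betw_def by auto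
  then show ?thesis unfolding inj_on_def by (metis imageI)
qed

text \<open>If adjacent faces had different signs, their orientations would contain a common dart.
  Coherence with \<open>id\<close> would then identify the two faces, yet no face contains a dart
  together with its reverse.\<close>

lemma orientation_constant:
  assumes "id \<in> G"
    and coherent: "\<And>D1 D2 g d. D1 \<in> KFD \<Longrightarrow> D2 \<in> KFD \<Longrightarrow> g \<in> G \<Longrightarrow> d \<in> ori \<sigma> D1 \<Longrightarrow>
      map_prod g g d \<in> ori \<sigma> D2 \<Longrightarrow> fst ` D2 = g ` fst ` D1"
    and D: "D \<in> KFD"
  shows "\<sigma> D = \<sigma> (hexD (0,0))"
  using _ _ D
proof (rule face_connected)
  fix D1 D2 x y
  assume D: "D1 \<in> KFD" "D2 \<in> KFD" "(x,y) \<in> D1" "(y,x) \<in> D2" "\<sigma> D1 = \<sigma> (hexD (0,0))"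
  have "\<sigma> D1 = \<sigma> D2"
  proof (rule ccontr)
    assume "\<sigma> D1 \<noteq> \<sigma> D2"
    with D(3,4) have "(x,y) \<in> ori \<sigma> D1 \<and> (x,y) \<in> ori \<sigma> D2 \<or> (y,x) \<in> ori \<sigma> D1 \<and> (y,x) \<in> ori \<sigma> D2"
      by (cases "\<sigma> D1") (simp_all add: ori_def)
    then obtain d where "d \<in> ori \<sigma> D1" "d \<in> ori \<sigma> D2" by blast
    then have "fst ` D2 = fst ` D1"
      using coherent[OF D(1,2) assms(1), of d] by (simp add: prod.map_id)
    then have "D1 = D2" using face_eqI D by metis
    then show False using face_no_reverse D by blast
  qed
  then show "\<sigma> D2 = \<sigma> (hexD (0,0))" using D(5) by simp
qed simp

text \<open>Equivariance of \<open>\<sigma>\<close> sends the chosen orientation of \<open>D\<close>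
  to that of its image face. Both signs agree, so either both boundaries are unchanged or both are
  reversed, and reversal cancels.\<close>

lemma orientation_preserved:
  assumes G: "free_subgroup G" "orientable_X G" and g: "g \<in> G" and D: "D \<in> KFD"
  shows "map_prod g g ` D \<in> KFD"
proof -
  obtain \<sigma> where equiv: "\<And>g D D'. g \<in> G \<Longrightarrow> D \<in> KFD \<Longrightarrow> D' \<in> KFD \<Longrightarrow> fst ` D' = g ` fst ` D \<Longrightarrow>
        map_prod g g ` ori \<sigma> D = ori \<sigma> D'"
    and coherent: "\<And>D1 D2 g d. D1 \<in> KFD \<Longrightarrow> D2 \<in> KFD \<Longrightarrow> g \<in> G \<Longrightarrow> d \<in> ori \<sigma> D1 \<Longrightarrow>
      map_prod g g d \<in> ori \<sigma> D2 \<Longrightarrow> fst ` D2 = g ` fst ` D1"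
    using G(2) unfolding orientable_X_def by metis
  have "id \<in> G" "autK g" using G(1) g unfolding free_subgroup_def by auto
  have "fst ` D \<in> KF" using D unfolding KF_def by blast
  then have "g ` fst ` D \<in> KF"
    using \<open>autK g\<close> face_subset_KV[OF D] unfolding autK_def by blast
  then obtain D' where D': "D' \<in> KFD" "fst ` D' = g ` fst ` D" unfolding KF_def by auto
  have eq: "map_prod g g ` ori \<sigma> D = ori \<sigma> D'" by (rule equiv[OF g D D'])
  have "\<sigma> E = \<sigma> (hexD (0,0))" if "E \<in> KFD" for E
    by (rule orientation_constant[where G = G and \<sigma> = \<sigma>, OF \<open>id \<in> G\<close> _ that]) (rule coherent)
  then have "\<sigma> D = \<sigma> D'" using D D'(1) by simp
  then have "map_prod g g ` D = D'"
  proof (cases "\<sigma> D")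
    case False
    then have "map_prod g g ` D\<inverse> = D'\<inverse>" using eq \<open>\<sigma> D = \<sigma> D'\<close> by (simp add: ori_def)
    then have "(map_prod g g ` D\<inverse>)\<inverse> = D'" by simp
    moreover have "(map_prod g g ` D\<inverse>)\<inverse> = map_prod g g ` D" by force
    ultimately show ?thesis by simp
  qed (use eq in \<open>simp add: ori_def\<close>)
  then show ?thesis using D' by simp
qed

text \<open>A half turn fixes a hexagon or an edge: its centre \<open>s / 2\<close> is a lattice point or the
  midpoint of a lattice edge.\<close>

lemma half_turn_not_free:
  assumes G: "free_subgroup G" and g: "g \<in> G" and s: "centre s"
    and eq: "\<And>p. p \<in> KV \<Longrightarrow> g p = aff (-1) s p"
  shows False
proof -
  have "(1,0) \<in> KV" "(2,0) \<in> KV" by (simp_all add: KV_eq)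
  \<comment> \<open>A half turn fixing (1,0) would have first coordinate of \<open>s\<close> equal
    to 2, one fixing (2,0) would have 4.\<close>
  then have "g \<noteq> id" using eq[of "(1,0)"] eq[of "(2,0)"] by (auto simp: aff_def)
  then have free: "\<And>e. e \<in> KE \<Longrightarrow> g ` e \<noteq> e" "\<And>F. F \<in> KF \<Longrightarrow> g ` F \<noteq> F"
    using G g unfolding free_subgroup_def by auto
  obtain u v where uv: "s = (u,v)" by (cases s)
  show False
  proof (cases "even u \<and> even v")
    case True
    then obtain x y where xy: "u = 2*x" "v = 2*y" by (auto elim!: evenE)
    then have c: "centre (x,y)" using s uv by (simp add: centre_eq) presburger
    have "g ` fst ` hexD (x,y) = aff (-1) s ` fst ` hexD (x,y)"
      using face_subset_KV[OF hexD_in[OF c]] eq by (intro image_cong) auto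
    also have "\<dots> = fst ` hexD (x,y)" using uv xy by (auto simp: hexD_eq aff_def)
    finally show False using free(2) hexD_in[OF c] unfolding KF_def by blast
  next
    case False
    then consider "odd u" "even v" | "even u" "odd v" | "odd u" "odd v" by blast
    then obtain a b i j where ab: "u = 2*a + i" "v = 2*b + j" "(i,j) \<in> {(1,0),(0,1),(1,-1)}"
    proof cases
      case 1
      then obtain a b where "u = 2*a + 1" "v = 2*b" by (auto elim!: evenE oddE)
      then show thesis using that[of a 1 b 0] by simp
    next
      case 2
      then obtain a b where "u = 2*a" "v = 2*b + 1" by (auto elim!: evenE oddE)
      then show thesis using that[of a 0 b 1] by simp
    next
      case 3
      then obtain a b where "u = 2*a + 1" "v = 2*b + 1" by (auto elim!: evenE oddE)
      \<comment> \<open>The direction (1,1) is no lattice edge, so \<open>b\<close> is raised by 1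
        to use (1,-1) with the same midpoint s/2.\<close>
      then show thesis using that[of a 1 "b+1" "-1"] by simp
    qed
    \<comment> \<open>The endpoints sum to the centre \<open>s\<close>, so if one were a centre both
      would be, but i - j is not divisible by 5.\<close>
    have KV: "(a,b) \<in> KV" "(a+i,b+j) \<in> KV"
      using ab s uv by (auto simp: KV_eq centre_eq; presburger)+
    have "adj (a,b) (a+i,b+j)" using ab(3) by (auto simp: adj_eq)
    then have "{(a,b),(a+i,b+j)} \<in> KE" using KV unfolding KE_def by blast
    moreover have "g ` {(a,b),(a+i,b+j)} = {(a,b),(a+i,b+j)}"
      using eq[OF KV(1)] eq[OF KV(2)] ab uv by (auto simp: aff_def)
    ultimately show False using free(1) by blast
  qed
qed

lemma deck_translation:
  assumes "free_subgroup G" "orientable_X G" "g \<in> G"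
  obtains s where "centre s" "\<And>p. p \<in> KV \<Longrightarrow> g p = aff 1 s p"
proof -
  have "inj_on g KV"
    using assms autK_inj unfolding free_subgroup_def by (metis inj_on_subset subset_UNIV)
  from face_map_aff[OF orientation_preserved[OF assms] this] obtain e s
    where "e = 1 \<or> e = -1" "centre s" "\<And>p. p \<in> KV \<Longrightarrow> g p = aff e s p" by metis
  then show thesis using half_turn_not_free[OF assms(1,3)] that by metis
qed

section \<open>Symmetries of \<open>K\<close> descend to the quotient\<close>

text \<open>This is normalisation of \<open>G\<close>: translations commute with the deck
  translation \<open>g\<close>, while a half turn conjugates it to its inverse. So the witness is
  \<open>g\<close> for e = 1 and \<open>inv g\<close> for e = -1.\<close>

lemma vorb_aff_subset:
  assumes G: "free_subgroup G" "orientable_X G"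
    and e: "e = 1 \<or> e = -1" and s: "centre s" and v: "v \<in> KV"
  shows "vorb G (aff e s v) \<subseteq> aff e s ` vorb G v"
proof
  fix w assume "w \<in> vorb G (aff e s v)"
  then obtain g where g: "g \<in> G" "w = g (aff e s v)" unfolding vorb_def by blast
  obtain t where t: "centre t" "\<And>p. p \<in> KV \<Longrightarrow> g p = aff 1 t p"
    using deck_translation[OF G g(1)] by blast
  have w: "w = aff 1 t (aff e s v)" using t(2)[OF aff_KV[OF e s v]] g by simp
  have "\<exists>h\<in>G. aff e s (h v) = w"
    using e
  proof
    assume "e = 1"
    then have "aff e s (g v) = w" using t(2)[OF v] w by (simp add: aff_def)
    then show ?thesis using g by blast
  next
    assume e1: "e = -1"
    have "inv g \<in> G" "inj g" using G(1) g(1) autK_inj unfolding free_subgroup_def by auto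
    then obtain t' where t': "centre t'" "\<And>p. p \<in> KV \<Longrightarrow> inv g p = aff 1 t' p"
      using deck_translation[OF G] by blast
    have gv: "g v \<in> KV" using t(2)[OF v] aff_KV[OF _ t(1) v, of 1] by simp
    have "aff 1 t' (aff 1 t v) = v"
      using inv_f_f[OF \<open>inj g\<close>, of v] t'(2)[OF gv] t(2)[OF v] by simp
    then have "fst t' = - fst t" "snd t' = - snd t" by (auto simp: aff_def prod_eq_iff)
    then have "aff e s (inv g v) = w" using t'(2)[OF v] w e1 by (simp add: aff_def)
    then show ?thesis using \<open>inv g \<in> G\<close> by blast
  qed
  then show "w \<in> aff e s ` vorb G v" unfolding vorb_def by blast
qed

lemma vorb_aff:
  assumes G: "free_subgroup G" "orientable_X G"
    and e: "e = 1 \<or> e = -1" and s: "centre s" and v: "v \<in> KV"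
  shows "aff e s ` vorb G v = vorb G (aff e s v)"
proof
  define t where "t = (- e * fst s, - e * snd s)"
  have "centre t" unfolding t_def by (rule centre_inverse[OF s])
  then have "vorb G v \<subseteq> aff e t ` vorb G (aff e s v)"
    using vorb_aff_subset[OF G e _ aff_KV[OF e s v], of t] aff_inverse(2)[OF e] by (simp add: t_def)
  then have "aff e s ` vorb G v \<subseteq> aff e s ` aff e t ` vorb G (aff e s v)" by (rule image_mono)
  then show "aff e s ` vorb G v \<subseteq> vorb G (aff e s v)"
    using aff_inverse(1)[OF e, of s] by (simp add: t_def image_image)
qed (rule vorb_aff_subset[OF assms])

text \<open>Serves edges and faces alike. The inverse symmetry induces the inverse
  bijection.\<close>

lemma bij_betw_aff_family:
  assumes G: "free_subgroup G" "orientable_X G"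
    and \<F>: "\<And>F. F \<in> \<F> \<Longrightarrow> F \<subseteq> KV"
    and closed: "\<And>e s F. e = 1 \<or> e = -1 \<Longrightarrow> centre s \<Longrightarrow> F \<in> \<F> \<Longrightarrow> aff e s ` F \<in> \<F>"
    and e: "e = 1 \<or> e = -1" and s: "centre s"
  shows "bij_betw (\<lambda>S. image (aff e s) ` S) ((\<lambda>F. vorb G ` F) ` \<F>) ((\<lambda>F. vorb G ` F) ` \<F>)"
proof -
  define t where "t = (- e * fst s, - e * snd s)"
  have t: "centre t" unfolding t_def by (rule centre_inverse[OF s])
  have maps: "(\<lambda>S. image (aff e s) ` S) ` (\<lambda>F. vorb G ` F) ` \<F> \<subseteq> (\<lambda>F. vorb G ` F) ` \<F>"
    if s: "centre s" for s
  proof -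
    have "image (aff e s) ` vorb G ` F = vorb G ` aff e s ` F" if "F \<in> \<F>" for F
      using vorb_aff[OF G e s] \<F>[OF that] by (simp add: image_image) (rule image_cong, auto)
    then show ?thesis using closed[OF e s] by auto
  qed
  have "aff e t (aff e s p) = p" "aff e s (aff e t p) = p" for p
    using aff_inverse[OF e] by (simp_all add: t_def)
  then show ?thesis
    by (intro bij_betw_byWitness[where f' = "\<lambda>S. image (aff e t) ` S"] maps s t)
      (simp_all add: image_image)
qed

lemma aff_KE:
  assumes "e = 1 \<or> e = -1" "centre s" "E \<in> KE"
  shows "aff e s ` E \<in> KE"
proof -
  obtain p q where pq: "E = {p,q}" "p \<in> KV" "q \<in> KV" "adj p q" using assms(3) unfolding KE_def by blast
  have "adj (aff e s p) (aff e s q)"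
    using pq(4) assms(1) by (cases p; cases q) (auto simp: aff_def adj_eq)
  moreover have "aff e s ` E = {aff e s p, aff e s q}" using pq(1) by simp
  ultimately show ?thesis using pq(2,3) aff_KV[OF assms(1,2)] unfolding KE_def by blast
qed

lemma aff_KF:
  assumes "e = 1 \<or> e = -1" "centre s" "F \<in> KF"
  shows "aff e s ` F \<in> KF"
proof -
  obtain D where D: "D \<in> KFD" "F = fst ` D" using assms(3) unfolding KF_def by blast
  have "aff e s ` F = fst ` map_prod (aff e s) (aff e s) ` D" unfolding D by force
  then show ?thesis using aff_face[OF assms(1,2) D(1)] unfolding KF_def by blast
qed

lemma autX_aff:
  assumes G: "free_subgroup G" "orientable_X G" and es: "e = 1 \<or> e = -1" "centre s"
  shows "autX G (image (aff e s))"
  unfolding autX_def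
proof (intro conjI)
  show "bij_betw (\<lambda>S. image (aff e s) ` S) (XEV G) (XEV G)"
    unfolding XEV_def by (rule bij_betw_aff_family[OF G _ aff_KE es]) (auto simp: KE_def)
  show "bij_betw (\<lambda>S. image (aff e s) ` S) (XFV G) (XFV G)"
    unfolding XFV_def
    by (rule bij_betw_aff_family[OF G _ aff_KF es]) (use face_subset_KV in \<open>auto simp: KF_def\<close>)
  define t where "t = (- e * fst s, - e * snd s)"
  have t: "centre t" unfolding t_def by (rule centre_inverse[OF es(2)])
  have maps: "image (aff e s) ` XV G \<subseteq> XV G" if "centre s" for s
    using vorb_aff[OF G es(1) that] aff_KV[OF es(1) that] unfolding XV_def by auto
  have "aff e t (aff e s p) = p" "aff e s (aff e t p) = p" for p
    using aff_inverse[OF es(1)] by (simp_all add: t_def)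
  then show "bij_betw (image (aff e s)) (XV G) (XV G)"
    by (intro bij_betw_byWitness[where f' = "image (aff e t)"] maps es t) (simp_all add: image_image)
qed

section \<open>Counting the vertex orbits\<close>

lemma autX_comp:
  assumes "autX G \<alpha>" "autX G \<beta>" shows "autX G (\<lambda>x. \<beta> (\<alpha> x))"
  using assms bij_betw_trans[of \<alpha> _ _ \<beta>] bij_betw_trans[of "image \<alpha>" _ _ "image \<beta>"]
  unfolding autX_def by (auto simp: comp_def image_image)

text \<open>Precomposing with the automorphism induced by \<open>aff e s\<close> gives one
  inclusion; the same inclusion for the inverse symmetry gives the other.\<close>

lemma autX_orbit_aff:
  assumes G: "free_subgroup G" "orientable_X G" and es: "e = 1 \<or> e = -1" "centre s"
    and v: "v \<in> KV"
  shows "{\<alpha> (vorb G (aff e s v)) | \<alpha>. autX G \<alpha>} = {\<alpha> (vorb G v) | \<alpha>. autX G \<alpha>}"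
proof -
  have sub: "{\<alpha> (vorb G (aff e s v)) | \<alpha>. autX G \<alpha>} \<subseteq> {\<alpha> (vorb G v) | \<alpha>. autX G \<alpha>}"
    if "centre s" "v \<in> KV" for s v
    using vorb_aff[OF G es(1) that] autX_comp[OF autX_aff[OF G es(1) that(1)]]
    by (auto simp flip: vorb_aff[OF G es(1) that])
  show ?thesis
    using sub[OF es(2) v] sub[OF centre_inverse[OF es(2), of e] aff_KV[OF es v]]
    by (simp add: aff_inverse(2)[OF es(1), simplified])
qed

text \<open>Translations by centres keep a - b modulo 5 and half turns negate it. Residues 1 and 4
  lead to (1,0), of type [3^2,6^2]; residues 2 and 3 lead to (2,0), of type [3^4,6^1].\<close>

lemma KV_aff_representative:
  assumes "v \<in> KV"
  obtains e s v0 where "e = 1 \<or> e = -1" "centre s" "v0 \<in> {(1,0),(2,0)}" "v = aff e s v0"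
proof -
  obtain a b where v: "v = (a,b)" by (cases v)
  have "5 dvd a - 1 - b \<or> 5 dvd a + 1 - b \<or> 5 dvd a - 2 - b \<or> 5 dvd a + 2 - b"
    using assms unfolding v KV_eq by presburger
  then consider "5 dvd a - 1 - b" | "5 dvd a + 1 - b" | "5 dvd a - 2 - b" | "5 dvd a + 2 - b"
    by blast
  then show thesis
  proof cases
    case 1 then show ?thesis using that[of 1 "(a-1,b)" "(1,0)"] v by (simp add: centre_eq aff_def)
  next
    case 2 then show ?thesis using that[of "-1" "(a+1,b)" "(1,0)"] v by (simp add: centre_eq aff_def)
  next
    case 3 then show ?thesis using that[of 1 "(a-2,b)" "(2,0)"] v by (simp add: centre_eq aff_def)
  next
    case 4 then show ?thesis using that[of "-1" "(a+2,b)" "(2,0)"] v by (simp add: centre_eq aff_def)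
  qed
qed

theorem theorem1:
  fixes G :: "(pt \<Rightarrow> pt) set"
  assumes "free_subgroup G"
    and "torus_quotient G"
    and "polyhedral_X G"
  shows "finite (autX_orbits G) \<and> card (autX_orbits G) \<le> 3"
proof -
  have G: "free_subgroup G" "orientable_X G" using assms unfolding torus_quotient_def by auto
  define orb where "orb v = {\<alpha> (vorb G v) | \<alpha>. autX G \<alpha>}" for v
  have "orb v \<in> {orb (1,0), orb (2,0)}" if "v \<in> KV" for v
  proof -
    obtain e s v0 where v0: "e = 1 \<or> e = -1" "centre s" "v0 \<in> {(1,0),(2,0)}" "v = aff e s v0"
      using KV_aff_representative[OF \<open>v \<in> KV\<close>] by blast
    then have "v0 \<in> KV" by (auto simp: KV_eq)
    then have "orb v = orb v0"
      unfolding orb_def v0(4) by (rule autX_orbit_aff[OF G v0(1,2)])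
    then show ?thesis using v0(3) by auto
  qed
  then have "orb ` KV \<subseteq> {orb (1,0), orb (2,0)}" by (rule image_subsetI)
  moreover have "autX_orbits G = orb ` KV"
    unfolding autX_orbits_def XV_def orb_def by (simp only: image_image)
  ultimately have sub: "autX_orbits G \<subseteq> {orb (1,0), orb (2,0)}" by (simp only:)
  \<comment> \<open>The two representatives may share an orbit, so the count is bounded by 2, which
    is sharper than the stated 3.\<close>
  have "card (autX_orbits G) \<le> card {orb (1,0), orb (2,0)}" by (rule card_mono[OF _ sub]) simp
  also have "\<dots> \<le> 2" by (simp add: card_insert_if)
  finally show ?thesis using finite_subset[OF sub] by simp
qed

end
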